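(* Let $Y=\mathbb{R}^n$ or $Y=\mathbb{C}^n$, let $\hat Y=Y\cup\{\infty\}$ be its one-point compactification, let $X\subset Y$, and let $\partial X$ be the boundary of $X$ in $\hat Y$. Let $\mathcal{H}$ be an infinite-dimensional complex reproducing kernel Hilbert space of functions on $X$ with kernels $k_w$ ($w\in X$), such that $k_a\neq 0$ for all $a\in X$ and $\{k_a,k_b\}$ is linearly independent whenever $a\ne b$. Assume that whenever $(w_n)$ is a sequence in $X$ with $w_n\to w\in\partial X\setminus X$, one has $$\lim_{n\to\infty}\frac{k_{w_n}(z)}{\|k_{w_n}\|}=0\quad\text{for all } z\in X.$$ Assume also that the kernel $k:X\times X\to\mathbb{C}$ is a continuous function. Then $\mathrm{Gr}_{\mathbf{p}}(\mathcal{H})=\{\mathcal{Z}_a:a\in X\}$ is closed in $\mathrm{Gr}(\mathcal{H})$, where $\mathcal{Z}_a=\{f\in\mathcal{H}:f(a)=0\}$.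
   Context: The kernel $k_w\in\mathcal{H}$ satisfies $f(w)=\langle f,k_w\rangle$ for all $f\in\mathcal{H}$, and $k(z,w)=k_w(z)$. $\mathrm{Gr}(\mathcal{H})$ is the set of closed subspaces of $\mathcal{H}$, identified with the set of orthogonal projections in $\mathcal{B}(\mathcal{H})$ (a subspace corresponds to the orthogonal projection onto it), with the operator norm topology. *)

theory Defs
  imports "HOL-Analysis.Analysis" "HOL-Library.Function_Algebras"
begin

definition fscale :: "complex \<Rightarrow> ('a \<Rightarrow> complex) \<Rightarrow> ('a \<Rightarrow> complex)" where
  "fscale c f = (\<lambda>x. c * f x)"

interpretation cfun: vector_space "fscale :: complex \<Rightarrow> ('a \<Rightarrow> complex) \<Rightarrow> ('a \<Rightarrow> complex)"
  by unfold_locales (auto simp: fscale_def fun_eq_iff algebra_simps)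

definition hnorm :: "(('a \<Rightarrow> complex) \<Rightarrow> ('a \<Rightarrow> complex) \<Rightarrow> complex) \<Rightarrow> ('a \<Rightarrow> complex) \<Rightarrow> real" where
  "hnorm ip f = sqrt (Re (ip f f))"

(* Metric_space demands nonnegativity and symmetry of the distance on the whole type, whereas ip
   is unconstrained outside H; hence the guard. *)
definition hdist ::
    "('a \<Rightarrow> complex) set \<Rightarrow> (('a \<Rightarrow> complex) \<Rightarrow> ('a \<Rightarrow> complex) \<Rightarrow> complex) \<Rightarrow>
     ('a \<Rightarrow> complex) \<Rightarrow> ('a \<Rightarrow> complex) \<Rightarrow> real" where
  "hdist H ip f g = (if f \<in> H \<and> g \<in> H then hnorm ip (f - g) else 0)"

(* The inner product is linear in the first argument. *)
locale complex_inner_product_on =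
  fixes H :: "('a \<Rightarrow> complex) set"
    and ip :: "('a \<Rightarrow> complex) \<Rightarrow> ('a \<Rightarrow> complex) \<Rightarrow> complex"
  assumes subspace: "cfun.subspace H"
    and ip_add_left: "\<lbrakk>f \<in> H; g \<in> H; h \<in> H\<rbrakk> \<Longrightarrow> ip (f + g) h = ip f h + ip g h"
    and ip_scale_left: "\<lbrakk>f \<in> H; g \<in> H\<rbrakk> \<Longrightarrow> ip (fscale c f) g = c * ip f g"
    and ip_commute: "\<lbrakk>f \<in> H; g \<in> H\<rbrakk> \<Longrightarrow> ip g f = cnj (ip f g)"
    and ip_pos: "\<lbrakk>f \<in> H; f \<noteq> 0\<rbrakk> \<Longrightarrow> 0 < Re (ip f f)"

locale complex_hilbert_on = complex_inner_product_on +
  assumes complete: "Metric_space.mcomplete H (hdist H ip)"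

(* Functions on X are represented by total functions that vanish outside X, and k w is the kernel
   at w.  A kernel with the reproducing property makes the point evaluations at X bounded; it is
   determined by H and ip. *)
locale rkhs = complex_hilbert_on H ip
  for X :: "'a set"
    and H :: "('a \<Rightarrow> complex) set"
    and ip :: "('a \<Rightarrow> complex) \<Rightarrow> ('a \<Rightarrow> complex) \<Rightarrow> complex"
    and k :: "'a \<Rightarrow> 'a \<Rightarrow> complex" +
  assumes vanish_outside: "\<lbrakk>f \<in> H; x \<notin> X\<rbrakk> \<Longrightarrow> f x = 0"
    and kernel_mem: "w \<in> X \<Longrightarrow> k w \<in> H"
    and reproducing: "\<lbrakk>w \<in> X; f \<in> H\<rbrakk> \<Longrightarrow> f w = ip f (k w)"

definition infinite_dimensional :: "('a \<Rightarrow> complex) set \<Rightarrow> bool" where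
  "infinite_dimensional H \<longleftrightarrow> \<not> (\<exists>B. finite B \<and> cfun.span B = H)"

definition grassmannian ::
    "('a \<Rightarrow> complex) set \<Rightarrow> (('a \<Rightarrow> complex) \<Rightarrow> ('a \<Rightarrow> complex) \<Rightarrow> complex) \<Rightarrow> ('a \<Rightarrow> complex) set set" where
  "grassmannian H ip = {M. cfun.subspace M \<and> closedin (Metric_space.mtopology H (hdist H ip)) M}"

definition orth_proj ::
    "(('a \<Rightarrow> complex) \<Rightarrow> ('a \<Rightarrow> complex) \<Rightarrow> complex) \<Rightarrow> ('a \<Rightarrow> complex) set \<Rightarrow> ('a \<Rightarrow> complex) \<Rightarrow> ('a \<Rightarrow> complex)" where
  "orth_proj ip M f = (THE g. g \<in> M \<and> (\<forall>h\<in>M. ip (f - g) h = 0))"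

definition op_norm ::
    "('a \<Rightarrow> complex) set \<Rightarrow> (('a \<Rightarrow> complex) \<Rightarrow> ('a \<Rightarrow> complex) \<Rightarrow> complex) \<Rightarrow>
     (('a \<Rightarrow> complex) \<Rightarrow> ('a \<Rightarrow> complex)) \<Rightarrow> real" where
  "op_norm H ip T = Sup {hnorm ip (T f) |f. f \<in> H \<and> hnorm ip f \<le> 1}"

(* The operator norm distance of the associated projections; guarded as hdist is. *)
definition gr_dist ::
    "('a \<Rightarrow> complex) set \<Rightarrow> (('a \<Rightarrow> complex) \<Rightarrow> ('a \<Rightarrow> complex) \<Rightarrow> complex) \<Rightarrow>
     ('a \<Rightarrow> complex) set \<Rightarrow> ('a \<Rightarrow> complex) set \<Rightarrow> real" where
  "gr_dist H ip M N =
     (if M \<in> grassmannian H ip \<and> N \<in> grassmannian H ip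
      then op_norm H ip (\<lambda>f. orth_proj ip M f - orth_proj ip N f) else 0)"

definition gr_topology ::
    "('a \<Rightarrow> complex) set \<Rightarrow> (('a \<Rightarrow> complex) \<Rightarrow> ('a \<Rightarrow> complex) \<Rightarrow> complex) \<Rightarrow> ('a \<Rightarrow> complex) set topology" where
  "gr_topology H ip = Metric_space.mtopology (grassmannian H ip) (gr_dist H ip)"

definition zero_space :: "('a \<Rightarrow> complex) set \<Rightarrow> 'a \<Rightarrow> ('a \<Rightarrow> complex) set" where
  "zero_space H a = {f \<in> H. f a = 0}"

definition gr_points :: "'a set \<Rightarrow> ('a \<Rightarrow> complex) set \<Rightarrow> ('a \<Rightarrow> complex) set set" where
  "gr_points X H = {zero_space H a |a. a \<in> X}"

(* In the one-point compactification a point y is Some y, and infinity is None. *)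
definition compactified_boundary :: "'a::euclidean_space set \<Rightarrow> 'a option set" where
  "compactified_boundary X = Alexandroff_compactification euclidean frontier_of (Some ` X)"

end

theory Submission
  imports Defs
begin

text \<open>Since \<open>zero_space H a\<close> is the orthogonal complement of \<open>k a\<close>, an element \<open>f\<close> lies at distance
  \<open>\<bar>f a\<bar> / \<parallel>k a\<parallel>\<close> from it.  Hence, if \<open>zero_space H (a n)\<close> converges to \<open>N\<close>, then \<open>f \<in> N\<close> holds iff
  \<open>\<bar>f (a n)\<bar> / \<parallel>k (a n)\<parallel>\<close> tends to 0.  Pass to a subsequence for which \<open>a n\<close> converges in the
  one-point compactification.  If the limit is a point \<open>b\<close> of \<open>X\<close>, continuity of the kernel gives
  \<open>k (a n) \<longlonglongrightarrow> k b\<close> in norm, so that \<open>N = zero_space H b\<close>.  Otherwise the boundary hypothesis puts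
  every \<open>k z\<close> into \<open>N\<close>, whence \<open>N = H\<close>; but \<open>H\<close> has distance at least 1 from every
  \<open>zero_space H a\<close>.\<close>

section \<open>Inner product geometry on \<open>H\<close>: norm, Cauchy-Schwarz, parallelogram
  law\<close>

context complex_inner_product_on
begin

lemma zero_mem [simp]: "0 \<in> H"
  using cfun.subspace_0[OF subspace] .

lemma add_mem [simp]: "\<lbrakk>f \<in> H; g \<in> H\<rbrakk> \<Longrightarrow> f + g \<in> H"
  using cfun.subspace_add[OF subspace] .

lemma diff_mem [simp]: "\<lbrakk>f \<in> H; g \<in> H\<rbrakk> \<Longrightarrow> f - g \<in> H"
  using cfun.subspace_diff[OF subspace] .

lemma scale_mem [simp]: "f \<in> H \<Longrightarrow> fscale c f \<in> H"
  using cfun.subspace_scale[OF subspace] .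

lemma ip_scale_right: "\<lbrakk>f \<in> H; g \<in> H\<rbrakk> \<Longrightarrow> ip f (fscale c g) = cnj c * ip f g"
  by (metis complex_cnj_mult ip_commute ip_scale_left scale_mem)

lemma ip_add_right: "\<lbrakk>f \<in> H; g \<in> H; h \<in> H\<rbrakk> \<Longrightarrow> ip f (g + h) = ip f g + ip f h"
  by (metis add_mem complex_cnj_add ip_add_left ip_commute)

lemma ip_diff_left: "\<lbrakk>f \<in> H; g \<in> H; h \<in> H\<rbrakk> \<Longrightarrow> ip (f - g) h = ip f h - ip g h"
  using ip_add_left[of "f - g" g h] by simp

lemma ip_diff_right: "\<lbrakk>f \<in> H; g \<in> H; h \<in> H\<rbrakk> \<Longrightarrow> ip f (g - h) = ip f g - ip f h"
  using ip_add_right[of f "g - h" h] by simp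

lemma ip_zero_left [simp]: "f \<in> H \<Longrightarrow> ip 0 f = 0"
  using ip_diff_left[of f f f] by simp

lemma ip_zero_right [simp]: "f \<in> H \<Longrightarrow> ip f 0 = 0"
  using ip_diff_right[of f f f] by simp

lemmas ip_simps = ip_add_left ip_add_right ip_diff_left ip_diff_right ip_scale_left ip_scale_right

lemma hnorm_nonneg [simp]: "f \<in> H \<Longrightarrow> 0 \<le> hnorm ip f"
  using ip_pos[of f] by (cases "f = 0") (auto simp: hnorm_def)

text \<open>Conjugate symmetry makes \<open>ip f f\<close> real, and \<open>ip_pos\<close> makes it
  nonnegative, so the square undoes the root in \<open>hnorm\<close>.\<close>

lemma ip_self: "f \<in> H \<Longrightarrow> ip f f = complex_of_real ((hnorm ip f)\<^sup>2)"
  using ip_pos[of f] ip_commute[of f f]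
  by (cases "f = 0") (auto simp: hnorm_def complex_eq_iff)

lemma hnorm_sq: "f \<in> H \<Longrightarrow> (hnorm ip f)\<^sup>2 = Re (ip f f)"
  by (simp add: ip_self)

lemma hnorm_zero [simp]: "hnorm ip 0 = 0"
  by (simp add: hnorm_def)

lemma hnorm_eq_0_iff [simp]: "f \<in> H \<Longrightarrow> hnorm ip f = 0 \<longleftrightarrow> f = 0"
  using ip_pos[of f] by (cases "f = 0") (auto simp: hnorm_def)

lemma hnorm_pos: "\<lbrakk>f \<in> H; f \<noteq> 0\<rbrakk> \<Longrightarrow> 0 < hnorm ip f"
  using hnorm_nonneg[of f] hnorm_eq_0_iff[of f] by linarith

lemma hnorm_scale: "f \<in> H \<Longrightarrow> hnorm ip (fscale c f) = cmod c * hnorm ip f"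
proof -
  assume f: "f \<in> H"
  have "ip (fscale c f) (fscale c f) = (c * cnj c) * ip f f"
    using f by (simp add: ip_simps)
  also have "\<dots> = complex_of_real ((cmod c * hnorm ip f)\<^sup>2)"
    using f by (simp add: ip_self complex_norm_square[symmetric] power_mult_distrib)
  finally have "(hnorm ip (fscale c f))\<^sup>2 = (cmod c * hnorm ip f)\<^sup>2"
    using f by (metis Re_complex_of_real hnorm_sq scale_mem)
  then show ?thesis using f by (simp add: power2_eq_iff_nonneg)
qed

lemma hnorm_diff_commute: "\<lbrakk>f \<in> H; g \<in> H\<rbrakk> \<Longrightarrow> hnorm ip (f - g) = hnorm ip (g - f)"
  using hnorm_scale[of "g - f" "-1"] by simp

lemma hnorm_sq_diff:
  "\<lbrakk>f \<in> H; g \<in> H\<rbrakk> \<Longrightarrow> (hnorm ip (f - g))\<^sup>2 = (hnorm ip f)\<^sup>2 - 2 * Re (ip f g) + (hnorm ip g)\<^sup>2"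
  using ip_commute[of f g] by (simp add: hnorm_sq ip_simps)

lemma hnorm_sq_add:
  "\<lbrakk>f \<in> H; g \<in> H\<rbrakk> \<Longrightarrow> (hnorm ip (f + g))\<^sup>2 = (hnorm ip f)\<^sup>2 + 2 * Re (ip f g) + (hnorm ip g)\<^sup>2"
  using ip_commute[of f g] by (simp add: hnorm_sq ip_simps)

text \<open>Pythagoras: the vector subtracted is the projection of \<open>f\<close> onto the line
  through \<open>h\<close>. Nonnegativity of the left side yields Cauchy-Schwarz; the decrease on
  the right side later shows that a nearest point has an orthogonal residual.\<close>

lemma hnorm_sq_diff_component:
  assumes "f \<in> H" "h \<in> H" "h \<noteq> 0"
  shows "(hnorm ip (f - fscale (ip f h / complex_of_real ((hnorm ip h)\<^sup>2)) h))\<^sup>2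
    = (hnorm ip f)\<^sup>2 - (cmod (ip f h))\<^sup>2 / (hnorm ip h)\<^sup>2"
proof -
  define r where "r = (hnorm ip h)\<^sup>2"
  have r: "r > 0" using hnorm_pos assms by (simp add: r_def)
  define c where "c = ip f h / complex_of_real r"
  have n: "(hnorm ip (fscale c h))\<^sup>2 = (cmod (ip f h))\<^sup>2 / r"
    using assms r
    by (simp add: hnorm_scale power_mult_distrib c_def norm_divide power_divide flip: r_def)
      (simp add: power2_eq_square)
  have "ip f (fscale c h) = complex_of_real ((cmod (ip f h))\<^sup>2 / r)"
    using assms r by (simp add: ip_simps c_def complex_norm_square[symmetric] mult.commute)
  then have "Re (ip f (fscale c h)) = (cmod (ip f h))\<^sup>2 / r" by simp
  then show ?thesis
    using assms n hnorm_sq_diff[of f "fscale c h"] by (simp add: c_def r_def)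
qed

lemma Cauchy_Schwarz:
  assumes "f \<in> H" "h \<in> H"
  shows "cmod (ip f h) \<le> hnorm ip f * hnorm ip h"
proof (cases "h = 0")
  case False
  then have "0 < hnorm ip h" using assms hnorm_pos by blast
  moreover have "0 \<le> (hnorm ip f)\<^sup>2 - (cmod (ip f h))\<^sup>2 / (hnorm ip h)\<^sup>2"
    using hnorm_sq_diff_component[OF assms False] by (metis zero_le_power2)
  ultimately have "(cmod (ip f h))\<^sup>2 \<le> (hnorm ip f * hnorm ip h)\<^sup>2"
    by (simp add: power_mult_distrib field_simps)
  then show ?thesis by (rule power2_le_imp_le) (use assms in simp)
qed (use assms in simp)

lemma hnorm_triangle:
  assumes "f \<in> H" "g \<in> H"
  shows "hnorm ip (f + g) \<le> hnorm ip f + hnorm ip g"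
proof (rule power2_le_imp_le)
  have "Re (ip f g) \<le> hnorm ip f * hnorm ip g"
    using Cauchy_Schwarz[OF assms] complex_Re_le_cmod order_trans by blast
  then show "(hnorm ip (f + g))\<^sup>2 \<le> (hnorm ip f + hnorm ip g)\<^sup>2"
    using assms by (simp add: hnorm_sq_add power2_sum)
qed (use assms in simp)

lemma hnorm_triangle_sub:
  assumes "f \<in> H" "g \<in> H"
  shows "hnorm ip f \<le> hnorm ip (f - g) + hnorm ip g"
  using hnorm_triangle[of "f - g" g] assms by simp

lemma parallelogram:
  assumes "f \<in> H" "g \<in> H"
  shows "(hnorm ip (f + g))\<^sup>2 + (hnorm ip (f - g))\<^sup>2 = 2 * (hnorm ip f)\<^sup>2 + 2 * (hnorm ip g)\<^sup>2"
  using assms by (simp add: hnorm_sq_add hnorm_sq_diff)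

section \<open>The metric of \<open>H\<close>, closed subspaces, and uniqueness of
  projections\<close>

sublocale hilbert_metric: Metric_space H "hdist H ip"
proof
  fix f g h
  show "0 \<le> hdist H ip f g" by (simp add: hdist_def)
  show "hdist H ip f g = hdist H ip g f" by (simp add: hdist_def hnorm_diff_commute)
  show "hdist H ip f g = 0 \<longleftrightarrow> f = g" if "f \<in> H" "g \<in> H" using that by (simp add: hdist_def)
  show "hdist H ip f h \<le> hdist H ip f g + hdist H ip g h" if "f \<in> H" "g \<in> H" "h \<in> H"
    using that hnorm_triangle[of "f - g" "g - h"] by (simp add: hdist_def)
qed

lemma limitin_iff_hnorm:
  assumes "\<And>n. s n \<in> H" "f \<in> H"
  shows "limitin hilbert_metric.mtopology s f sequentially \<longleftrightarrow> (\<lambda>n. hnorm ip (s n - f)) \<longlonglongrightarrow> 0"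
  using assms by (auto simp: hilbert_metric.limit_metric_sequentially LIMSEQ_def hdist_def)

text \<open>Closed sets of a metric space are the sequentially closed ones; in this form later
  arguments need only limits of \<open>hnorm\<close>.\<close>

lemma grassmannian_iff:
  "M \<in> grassmannian H ip \<longleftrightarrow> cfun.subspace M \<and> M \<subseteq> H \<and>
     (\<forall>s f. (\<forall>n. s n \<in> M) \<longrightarrow> f \<in> H \<longrightarrow> (\<lambda>n. hnorm ip (s n - f)) \<longlonglongrightarrow> 0 \<longrightarrow> f \<in> M)"
proof -
  have "closedin hilbert_metric.mtopology M \<longleftrightarrow> M \<subseteq> H \<and>
     (\<forall>s f. (\<forall>n. s n \<in> M) \<longrightarrow> f \<in> H \<longrightarrow> (\<lambda>n. hnorm ip (s n - f)) \<longlonglongrightarrow> 0 \<longrightarrow> f \<in> M)"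
    unfolding hilbert_metric.metric_closedin_iff_sequentially_closed
    by (smt (verit, best) hilbert_metric.limitin_mspace image_subset_iff limitin_iff_hnorm subsetD rangeI range_subsetD)
  then show ?thesis by (simp add: grassmannian_def)
qed

lemma tendsto_ip_left:
  assumes "\<And>n. s n \<in> H" "f \<in> H" "g \<in> H" "(\<lambda>n. hnorm ip (s n - f)) \<longlonglongrightarrow> 0"
  shows "(\<lambda>n. ip (s n) g) \<longlonglongrightarrow> ip f g"
proof (rule LIM_zero_cancel, rule Lim_null_comparison)
  show "\<forall>\<^sub>F n in sequentially. cmod (ip (s n) g - ip f g) \<le> hnorm ip (s n - f) * hnorm ip g"
    using Cauchy_Schwarz assms by (auto simp flip: ip_diff_left)
  show "(\<lambda>n. hnorm ip (s n - f) * hnorm ip g) \<longlonglongrightarrow> 0"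
    using tendsto_mult_left_zero assms(4) by blast
qed

lemma orthogonal_complement_mem_grassmannian:
  assumes "g \<in> H"
  shows "{f \<in> H. ip f g = 0} \<in> grassmannian H ip"
  unfolding grassmannian_iff
proof (intro conjI allI impI)
  show "cfun.subspace {f \<in> H. ip f g = 0}"
    using assms by (auto simp: cfun.subspace_def ip_simps)
  fix s f
  assume *: "\<forall>n. s n \<in> {f \<in> H. ip f g = 0}" "f \<in> H" "(\<lambda>n. hnorm ip (s n - f)) \<longlonglongrightarrow> 0"
  then have "(\<lambda>n. ip (s n) g) \<longlonglongrightarrow> ip f g" using assms tendsto_ip_left by blast
  with * have "ip f g = 0" by (simp add: LIMSEQ_const_iff)
  with * show "f \<in> {f \<in> H. ip f g = 0}" by simp
qed auto

text \<open>Two candidates for the \<open>THE\<close> differ by a vector of \<open>M\<close> that is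
  orthogonal to all of \<open>M\<close>, hence to itself. Projections can thus be computed by
  exhibiting a candidate.\<close>

lemma orth_proj_eqI:
  assumes "cfun.subspace M" "M \<subseteq> H" "f \<in> H" "g \<in> M" "\<And>h. h \<in> M \<Longrightarrow> ip (f - g) h = 0"
  shows "orth_proj ip M f = g"
  unfolding orth_proj_def
proof (rule the_equality)
  fix g' assume g': "g' \<in> M \<and> (\<forall>h\<in>M. ip (f - g') h = 0)"
  have "g \<in> H" "g' \<in> H" using assms g' by auto
  have d: "g - g' \<in> M" using assms g' cfun.subspace_diff by blast
  then have "ip (f - g') (g - g') = 0" "ip (f - g) (g - g') = 0" using g' assms by auto
  then have "ip (g - g') (g - g') = 0"
    using \<open>g \<in> H\<close> \<open>g' \<in> H\<close> assms(3) d by (simp add: ip_diff_left)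
  then show "g' = g"
    using ip_pos[of "g - g'"] \<open>g \<in> H\<close> \<open>g' \<in> H\<close> by fastforce
qed (use assms in blast)

end

section \<open>Existence of orthogonal projections, from completeness\<close>

context complex_hilbert_on
begin

lemma convergent_if_Cauchy:
  assumes "\<And>n. s n \<in> H" "\<And>e. e > 0 \<Longrightarrow> \<exists>N. \<forall>m\<ge>N. \<forall>n\<ge>N. hnorm ip (s m - s n) < e"
  obtains f where "f \<in> H" "(\<lambda>n. hnorm ip (s n - f)) \<longlonglongrightarrow> 0"
proof -
  have "hilbert_metric.MCauchy s"
    using assms unfolding hilbert_metric.MCauchy_def by (simp add: hdist_def image_subset_iff)
  then obtain f where "limitin hilbert_metric.mtopology s f sequentially"
    using complete unfolding hilbert_metric.mcomplete_def by blast
  then show thesis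
    using that assms(1) hilbert_metric.limitin_mspace limitin_iff_hnorm by blast
qed

text \<open>A minimising sequence is Cauchy by the parallelogram law, because midpoints of its terms
  stay in \<open>M\<close>; its limit attains the infimum since \<open>M\<close> is closed.\<close>

lemma nearest_point_exists:
  assumes M: "M \<in> grassmannian H ip" and f: "f \<in> H"
  obtains g where "g \<in> M" "\<And>h. h \<in> M \<Longrightarrow> hnorm ip (f - g) \<le> hnorm ip (f - h)"
proof -
  have sub: "cfun.subspace M" and MH: "M \<subseteq> H" using M by (auto simp: grassmannian_iff)
  define D where "D = (\<lambda>g. hnorm ip (f - g)) ` M"
  define d where "d = Inf D"
  have ne: "D \<noteq> {}" using cfun.subspace_0[OF sub] by (auto simp: D_def)
  have bd: "bdd_below D" using MH f by (auto simp: D_def bdd_below_def intro!: exI[of _ 0])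
  have dle: "d \<le> hnorm ip (f - h)" if "h \<in> M" for h
    using that bd by (auto simp: d_def D_def intro: cInf_lower)
  have d0: "0 \<le> d" unfolding d_def by (rule cInf_greatest[OF ne]) (use MH f in \<open>auto simp: D_def\<close>)
  have "\<exists>g. g \<in> M \<and> hnorm ip (f - g) < d + 1 / real (Suc n)" for n
    using cInf_lessD[OF ne, of "d + 1 / real (Suc n)"] by (auto simp: d_def D_def)
  then obtain s where sM: "\<And>n. s n \<in> M" and s: "\<And>n. hnorm ip (f - s n) < d + 1 / real (Suc n)"
    by metis
  have sH: "s n \<in> H" for n using sM MH by auto
  have lim_s: "(\<lambda>n. hnorm ip (f - s n)) \<longlonglongrightarrow> d"
  proof (rule tendsto_sandwich)
    show "\<forall>\<^sub>F n in sequentially. d \<le> hnorm ip (f - s n)" using dle sM by auto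
    show "\<forall>\<^sub>F n in sequentially. hnorm ip (f - s n) \<le> d + 1 / real (Suc n)"
      by (intro always_eventually allI less_imp_le s)
    show "(\<lambda>n. d + 1 / real (Suc n)) \<longlonglongrightarrow> d"
      using tendsto_add[OF tendsto_const[of d] LIMSEQ_Suc[OF lim_1_over_n]] by simp
  qed simp
  \<comment> \<open>The parallelogram law for \<open>f - s m\<close> and \<open>f - s n\<close>:
    their sum is twice the difference of \<open>f\<close> and the midpoint \<open>h\<close> in
    \<open>M\<close>, so its norm is at least \<open>2 * d\<close>.\<close>
  have gap: "(hnorm ip (s m - s n))\<^sup>2 \<le> 2 * (hnorm ip (f - s m))\<^sup>2 + 2 * (hnorm ip (f - s n))\<^sup>2 - 4 * d\<^sup>2" for m n
  proof -
    define h where "h = fscale (1/2) (s m + s n)"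
    have hM: "h \<in> M" using sM sub by (simp add: h_def cfun.subspace_add cfun.subspace_scale)
    have "(f - s m) + (f - s n) = fscale 2 (f - h)"
      by (auto simp: h_def fscale_def algebra_simps)
    then have "hnorm ip ((f - s m) + (f - s n)) = 2 * hnorm ip (f - h)"
      using hM MH f by (simp add: hnorm_scale subset_iff)
    then have "2 * d \<le> hnorm ip ((f - s m) + (f - s n))" using dle[OF hM] by simp
    then have "(2 * d)\<^sup>2 \<le> (hnorm ip ((f - s m) + (f - s n)))\<^sup>2" using d0 by (intro power_mono) auto
    moreover have "(f - s m) - (f - s n) = s n - s m" by simp
    ultimately show ?thesis
      using parallelogram[of "f - s m" "f - s n"] sH f hnorm_diff_commute[of "s m" "s n"]
      by (simp add: power_mult_distrib)
  qed
  have "\<exists>N. \<forall>m\<ge>N. \<forall>n\<ge>N. hnorm ip (s m - s n) < e" if "e > 0" for e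
  proof -
    have "(\<lambda>n. (hnorm ip (f - s n))\<^sup>2) \<longlonglongrightarrow> d\<^sup>2" using lim_s by (rule tendsto_power)
    \<comment> \<open>With both squared distances below this bound, \<open>gap\<close> leaves less
      than the square of \<open>e\<close>, the terms in \<open>d\<close> cancelling.\<close>
    moreover have "d\<^sup>2 < d\<^sup>2 + e\<^sup>2 / 4" using that by simp
    ultimately have "\<forall>\<^sub>F n in sequentially. (hnorm ip (f - s n))\<^sup>2 < d\<^sup>2 + e\<^sup>2 / 4"
      by (rule order_tendstoD)
    then obtain N where N: "\<And>n. n \<ge> N \<Longrightarrow> (hnorm ip (f - s n))\<^sup>2 < d\<^sup>2 + e\<^sup>2 / 4"
      by (auto simp: eventually_sequentially)
    have "hnorm ip (s m - s n) < e" if "m \<ge> N" "n \<ge> N" for m n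
    proof (rule power2_less_imp_less)
      show "(hnorm ip (s m - s n))\<^sup>2 < e\<^sup>2"
        using gap[of m n] N[OF that(1)] N[OF that(2)] by argo
    qed (use \<open>e > 0\<close> in simp)
    then show ?thesis by blast
  qed
  then obtain g where g: "g \<in> H" "(\<lambda>n. hnorm ip (s n - g)) \<longlonglongrightarrow> 0"
    using convergent_if_Cauchy[of s] sH by blast
  have gM: "g \<in> M" using M g sM unfolding grassmannian_iff by blast
  have "hnorm ip (f - g) \<le> d"
  proof (rule LIMSEQ_le_const)
    show "(\<lambda>n. hnorm ip (f - s n) + hnorm ip (s n - g)) \<longlonglongrightarrow> d"
      using tendsto_add[OF lim_s g(2)] by simp
    show "\<exists>N. \<forall>n\<ge>N. hnorm ip (f - g) \<le> hnorm ip (f - s n) + hnorm ip (s n - g)"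
      using hnorm_triangle[of "f - s n" "s n - g" for n] f sH g(1) by simp
  qed
  then show thesis using that[OF gM] dle by force
qed

text \<open>The nearest point \<open>g\<close> works: if \<open>f - g\<close> had a nonzero
  component along some \<open>h\<close> in \<open>M\<close>, adding that component to
  \<open>g\<close> would give a point of \<open>M\<close> strictly closer to
  \<open>f\<close>.\<close>

lemma orth_proj_exists:
  assumes M: "M \<in> grassmannian H ip" and f: "f \<in> H"
  obtains g where "g \<in> M" "\<And>h. h \<in> M \<Longrightarrow> ip (f - g) h = 0"
proof -
  have sub: "cfun.subspace M" and MH: "M \<subseteq> H" using M by (auto simp: grassmannian_iff)
  obtain g where gM: "g \<in> M" and g: "\<And>h. h \<in> M \<Longrightarrow> hnorm ip (f - g) \<le> hnorm ip (f - h)"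
    using nearest_point_exists[OF M f] by blast
  have "ip (f - g) h = 0" if h: "h \<in> M" "h \<noteq> 0" for h
  proof -
    define c where "c = ip (f - g) h / complex_of_real ((hnorm ip h)\<^sup>2)"
    have inH: "g \<in> H" "h \<in> H" using gM h MH by auto
    have "hnorm ip (f - g) \<le> hnorm ip (f - (g + fscale c h))"
      using gM h sub by (intro g) (simp add: cfun.subspace_add cfun.subspace_scale)
    also have "f - (g + fscale c h) = (f - g) - fscale c h" by simp
    finally have "(hnorm ip (f - g))\<^sup>2 \<le> (hnorm ip ((f - g) - fscale c h))\<^sup>2"
      by (rule power_mono) (use inH f in \<open>blast intro: hnorm_nonneg diff_mem\<close>)
    also have "\<dots> = (hnorm ip (f - g))\<^sup>2 - (cmod (ip (f - g) h))\<^sup>2 / (hnorm ip h)\<^sup>2"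
      unfolding c_def using inH f h by (intro hnorm_sq_diff_component) auto
    finally show ?thesis
      using hnorm_pos[OF inH(2) h(2)] by (simp add: divide_le_0_iff)
  qed
  moreover have "ip (f - g) 0 = 0" using f gM MH by auto
  ultimately show thesis using that[OF gM] by blast
qed

lemma
  assumes "M \<in> grassmannian H ip" "f \<in> H"
  shows orth_proj_in: "orth_proj ip M f \<in> M"
    and orth_proj_orthogonal: "h \<in> M \<Longrightarrow> ip (f - orth_proj ip M f) h = 0"
proof -
  obtain g where g: "g \<in> M" "\<And>h. h \<in> M \<Longrightarrow> ip (f - g) h = 0"
    using orth_proj_exists[OF assms] by blast
  then have "orth_proj ip M f = g"
    using assms by (intro orth_proj_eqI) (auto simp: grassmannian_iff)
  with g show "orth_proj ip M f \<in> M" "h \<in> M \<Longrightarrow> ip (f - orth_proj ip M f) h = 0" by auto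
qed

lemma grassmannian_subset: "\<lbrakk>M \<in> grassmannian H ip; f \<in> M\<rbrakk> \<Longrightarrow> f \<in> H"
  by (auto simp: grassmannian_iff)

lemma orth_proj_mem [simp]: "\<lbrakk>M \<in> grassmannian H ip; f \<in> H\<rbrakk> \<Longrightarrow> orth_proj ip M f \<in> H"
  using orth_proj_in grassmannian_subset by blast

lemma orth_proj_id:
  assumes M: "M \<in> grassmannian H ip" and f: "f \<in> M"
  shows "orth_proj ip M f = f"
  using assms by (intro orth_proj_eqI) (auto simp: grassmannian_iff)

lemma orth_proj_scale:
  assumes "M \<in> grassmannian H ip" "f \<in> H"
  shows "orth_proj ip M (fscale c f) = fscale c (orth_proj ip M f)"
proof (rule orth_proj_eqI)
  show "fscale c (orth_proj ip M f) \<in> M"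
    using assms orth_proj_in by (auto simp: grassmannian_iff intro: cfun.subspace_scale)
  show "ip (fscale c f - fscale c (orth_proj ip M f)) h = 0" if "h \<in> M" for h
    using assms that orth_proj_orthogonal[of M f h]
    by (simp add: ip_simps grassmannian_subset)
qed (use assms in \<open>auto simp: grassmannian_iff\<close>)

text \<open>Pythagoras for the orthogonal splitting of \<open>f\<close> into residual and
  projection.\<close>

lemma hnorm_diff_orth_proj_le:
  assumes M: "M \<in> grassmannian H ip" and f: "f \<in> H"
  shows "hnorm ip (f - orth_proj ip M f) \<le> hnorm ip f"
proof (rule power2_le_imp_le)
  have "ip (f - orth_proj ip M f) (orth_proj ip M f) = 0"
    using assms orth_proj_in orth_proj_orthogonal by blast
  then show "(hnorm ip (f - orth_proj ip M f))\<^sup>2 \<le> (hnorm ip f)\<^sup>2"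
    using hnorm_sq_add[of "f - orth_proj ip M f" "orth_proj ip M f"] assms by simp
qed (use f in simp)

section \<open>The operator norm distance as a metric on closed subspaces\<close>

lemma hnorm_orth_proj_diff_le_gr_dist:
  assumes M: "M \<in> grassmannian H ip" and N: "N \<in> grassmannian H ip" and f: "f \<in> H" "hnorm ip f \<le> 1"
  shows "hnorm ip (orth_proj ip M f - orth_proj ip N f) \<le> gr_dist H ip M N"
proof -
  let ?S = "{hnorm ip (orth_proj ip M f - orth_proj ip N f) |f. f \<in> H \<and> hnorm ip f \<le> 1}"
  \<comment> \<open>A real \<open>Sup\<close> dominates its set only if the set is bounded above.
    The bound 2 comes from inserting \<open>f\<close>: both residuals have norm at most 1.\<close>
  have "x \<le> 2" if "x \<in> ?S" for x
  proof -
    from that obtain f where x: "x = hnorm ip (orth_proj ip M f - orth_proj ip N f)"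
      and f: "f \<in> H" "hnorm ip f \<le> 1" by blast
    have "x \<le> hnorm ip (orth_proj ip M f - f) + hnorm ip (f - orth_proj ip N f)"
      using hnorm_triangle[of "orth_proj ip M f - f" "f - orth_proj ip N f"] f M N by (simp add: x)
    moreover have "hnorm ip (f - orth_proj ip K f) \<le> 1" if "K \<in> grassmannian H ip" for K
      using hnorm_diff_orth_proj_le[OF that f(1)] f(2) by linarith
    from this[OF M] this[OF N] have "hnorm ip (orth_proj ip M f - f) \<le> 1" "hnorm ip (f - orth_proj ip N f) \<le> 1"
      using M f hnorm_diff_commute[of f "orth_proj ip M f"] by auto
    ultimately show "x \<le> 2" by linarith
  qed
  then have "bdd_above ?S" by (meson bdd_above.I)
  then have "hnorm ip (orth_proj ip M f - orth_proj ip N f) \<le> Sup ?S"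
    using f by (intro cSup_upper) auto
  then show ?thesis using M N by (simp add: gr_dist_def op_norm_def)
qed

lemma gr_dist_leI:
  assumes M: "M \<in> grassmannian H ip" and N: "N \<in> grassmannian H ip"
    and "\<And>f. \<lbrakk>f \<in> H; hnorm ip f \<le> 1\<rbrakk> \<Longrightarrow> hnorm ip (orth_proj ip M f - orth_proj ip N f) \<le> c"
  shows "gr_dist H ip M N \<le> c"
proof -
  let ?S = "{hnorm ip (orth_proj ip M f - orth_proj ip N f) |f. f \<in> H \<and> hnorm ip f \<le> 1}"
  \<comment> \<open>A supremum is bounded by bounding the members only for a nonempty set; the zero
    vector supplies a member.\<close>
  have "hnorm ip (orth_proj ip M 0 - orth_proj ip N 0) \<in> ?S" by fastforce
  then have "?S \<noteq> {}" by blast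
  then have "Sup ?S \<le> c" by (rule cSup_least) (use assms in auto)
  then show ?thesis using M N by (simp add: gr_dist_def op_norm_def)
qed

text \<open>Normalising \<open>f\<close> reduces this to the unit ball, as projections commute with
  scaling.\<close>

lemma hnorm_orth_proj_diff_le:
  assumes M: "M \<in> grassmannian H ip" and N: "N \<in> grassmannian H ip" and f: "f \<in> H"
  shows "hnorm ip (orth_proj ip M f - orth_proj ip N f) \<le> gr_dist H ip M N * hnorm ip f"
proof (cases "f = 0")
  case True
  then show ?thesis using M N by (simp add: orth_proj_id grassmannian_iff cfun.subspace_0)
next
  case False
  define r where "r = hnorm ip f"
  have r: "r > 0" using hnorm_pos f False by (simp add: r_def)
  define g where "g = fscale (complex_of_real (1 / r)) f"
  have g: "g \<in> H" "hnorm ip g \<le> 1" using f r by (simp_all add: g_def hnorm_scale norm_divide flip: r_def)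
  have "orth_proj ip M g - orth_proj ip N g
      = fscale (complex_of_real (1 / r)) (orth_proj ip M f - orth_proj ip N f)"
    using M N f by (simp add: g_def orth_proj_scale cfun.scale_right_diff_distrib)
  then have "hnorm ip (orth_proj ip M g - orth_proj ip N g)
      = hnorm ip (orth_proj ip M f - orth_proj ip N f) / r"
    using M N f r by (simp add: hnorm_scale norm_divide)
  then show ?thesis
    using hnorm_orth_proj_diff_le_gr_dist[OF M N g] r by (simp add: pos_divide_le_eq flip: r_def)
qed

sublocale gr_metric: Metric_space "grassmannian H ip" "gr_dist H ip"
proof
  let ?G = "grassmannian H ip"
  fix M N K
  have ge0: "0 \<le> gr_dist H ip M N" for M N
  proof (cases "M \<in> ?G \<and> N \<in> ?G")
    case True
    then have "0 \<le> hnorm ip (orth_proj ip M 0 - orth_proj ip N 0)" by simp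
    also have "\<dots> \<le> gr_dist H ip M N" using True by (intro hnorm_orth_proj_diff_le_gr_dist) auto
    finally show ?thesis .
  qed (auto simp: gr_dist_def)
  have comm_le: "gr_dist H ip M N \<le> gr_dist H ip N M" for M N
  proof (cases "M \<in> ?G \<and> N \<in> ?G")
    case True
    then show ?thesis
      by (intro gr_dist_leI)
        (auto simp: hnorm_diff_commute[of "orth_proj ip M _"] intro: hnorm_orth_proj_diff_le_gr_dist)
  qed (auto simp: gr_dist_def)
  show "0 \<le> gr_dist H ip M N" by (rule ge0)
  show "gr_dist H ip M N = gr_dist H ip N M" using comm_le by (simp add: order_antisym)
  \<comment> \<open>At distance zero the two projections agree, and the one onto \<open>M\<close>
    fixes each \<open>f\<close> in \<open>M\<close>, so \<open>f\<close> is also its own projection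
    onto \<open>N\<close>. Symmetry gives the other inclusion.\<close>
  have le: "M \<subseteq> N" if "M \<in> ?G" "N \<in> ?G" "gr_dist H ip M N = 0" for M N
  proof
    fix f assume "f \<in> M"
    then have f: "f \<in> H" using that grassmannian_subset by blast
    then have "hnorm ip (orth_proj ip M f - orth_proj ip N f) \<le> 0"
      using hnorm_orth_proj_diff_le[OF that(1,2) f] that(3) by simp
    then have "hnorm ip (orth_proj ip M f - orth_proj ip N f) = 0"
      using f that by (intro order_antisym) auto
    then have "orth_proj ip M f - orth_proj ip N f = 0"
      by (subst (asm) hnorm_eq_0_iff) (use f that in auto)
    then have "orth_proj ip M f = orth_proj ip N f" by simp
    then show "f \<in> N" using orth_proj_id[OF that(1) \<open>f \<in> M\<close>] orth_proj_in[OF that(2) f] by simp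
  qed
  show "gr_dist H ip M N = 0 \<longleftrightarrow> M = N" if "M \<in> ?G" "N \<in> ?G"
  proof
    assume "M = N"
    then have "gr_dist H ip M N \<le> 0" using that by (intro gr_dist_leI) auto
    then show "gr_dist H ip M N = 0" using ge0[of M N] by simp
  qed (use le comm_le ge0 that in \<open>metis order_antisym\<close>)
  show "gr_dist H ip M K \<le> gr_dist H ip M N + gr_dist H ip N K" if "M \<in> ?G" "N \<in> ?G" "K \<in> ?G"
  proof (rule gr_dist_leI)
    fix f assume f: "f \<in> H" "hnorm ip f \<le> 1"
    have "hnorm ip (orth_proj ip M f - orth_proj ip K f)
        \<le> hnorm ip (orth_proj ip M f - orth_proj ip N f) + hnorm ip (orth_proj ip N f - orth_proj ip K f)"
      using hnorm_triangle[of "orth_proj ip M f - orth_proj ip N f" "orth_proj ip N f - orth_proj ip K f"] that f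
      by simp
    then show "hnorm ip (orth_proj ip M f - orth_proj ip K f) \<le> gr_dist H ip M N + gr_dist H ip N K"
      using hnorm_orth_proj_diff_le_gr_dist that f by (meson add_mono order_trans)
  qed (use that in auto)
qed

text \<open>Norm convergence of the projections implies their strong convergence.\<close>

lemma tendsto_orth_proj:
  assumes "limitin (gr_topology H ip) M N sequentially" "\<And>n. M n \<in> grassmannian H ip" "f \<in> H"
  shows "(\<lambda>n. hnorm ip (orth_proj ip (M n) f - orth_proj ip N f)) \<longlonglongrightarrow> 0"
proof (rule Lim_null_comparison)
  have N: "N \<in> grassmannian H ip" and "(\<lambda>n. gr_dist H ip (M n) N) \<longlonglongrightarrow> 0"
    using assms by (auto simp: gr_topology_def gr_metric.limitin_metric_dist_null)
  then show "(\<lambda>n. gr_dist H ip (M n) N * hnorm ip f) \<longlonglongrightarrow> 0"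
    by (simp add: tendsto_mult_left_zero)
  show "\<forall>\<^sub>F n in sequentially. norm (hnorm ip (orth_proj ip (M n) f - orth_proj ip N f)) \<le> gr_dist H ip (M n) N * hnorm ip f"
    using hnorm_orth_proj_diff_le assms N by simp
qed

text \<open>Removing from \<open>f\<close> its component along \<open>g\<close> leaves a vector
  orthogonal to \<open>g\<close>, and the removed multiple of \<open>g\<close> is orthogonal to the
  hyperplane.\<close>

lemma orth_proj_hyperplane:
  assumes "f \<in> H" "g \<in> H" "g \<noteq> 0"
  shows "orth_proj ip {f \<in> H. ip f g = 0} f = f - fscale (ip f g / complex_of_real ((hnorm ip g)\<^sup>2)) g"
proof (rule orth_proj_eqI)
  show "f - fscale (ip f g / complex_of_real ((hnorm ip g)\<^sup>2)) g \<in> {f \<in> H. ip f g = 0}"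
    using assms by (simp add: ip_simps ip_self)
  fix h assume "h \<in> {f \<in> H. ip f g = 0}"
  then show "ip (f - (f - fscale (ip f g / complex_of_real ((hnorm ip g)\<^sup>2)) g)) h = 0"
    using assms ip_commute[of h g] by (simp add: ip_simps)
qed (use assms orthogonal_complement_mem_grassmannian[of g] in \<open>auto simp: grassmannian_iff\<close>)

end

section \<open>Subspaces of functions vanishing at a point, and their limits\<close>

context rkhs
begin

lemma ip_kernel: "\<lbrakk>a \<in> X; b \<in> X\<rbrakk> \<Longrightarrow> ip (k a) (k b) = k a b"
  using reproducing[of b "k a"] kernel_mem by simp

lemma kernel_commute: "\<lbrakk>a \<in> X; b \<in> X\<rbrakk> \<Longrightarrow> k b a = cnj (k a b)"
  using ip_commute[of "k a" "k b"] kernel_mem by (simp add: ip_kernel)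

lemma zero_space_eq: "a \<in> X \<Longrightarrow> zero_space H a = {f \<in> H. ip f (k a) = 0}"
  using reproducing by (auto simp: zero_space_def)

lemma zero_space_mem_grassmannian: "a \<in> X \<Longrightarrow> zero_space H a \<in> grassmannian H ip"
  by (simp add: zero_space_eq kernel_mem orthogonal_complement_mem_grassmannian)

text \<open>The residual is \<open>k a\<close> times \<open>f a\<close> over the squared norm of
  \<open>k a\<close>; taking norms cancels one factor.\<close>

lemma hnorm_diff_orth_proj_zero_space:
  assumes "a \<in> X" "k a \<noteq> 0" "f \<in> H"
  shows "hnorm ip (f - orth_proj ip (zero_space H a) f) = cmod (f a) / hnorm ip (k a)"
proof -
  have "hnorm ip (k a) > 0" using assms kernel_mem hnorm_pos by blast
  moreover have "f - orth_proj ip (zero_space H a) f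
      = fscale (f a / complex_of_real ((hnorm ip (k a))\<^sup>2)) (k a)"
    using assms kernel_mem reproducing by (simp add: zero_space_eq orth_proj_hyperplane)
  ultimately show ?thesis
    using assms kernel_mem by (simp add: hnorm_scale norm_divide norm_mult power2_eq_square)
qed

text \<open>By the reverse triangle inequality, strong convergence of the projections carries over
  to the norms of the residuals.\<close>

lemma tendsto_normalized_eval:
  assumes lim: "limitin (gr_topology H ip) (\<lambda>n. zero_space H (a n)) N sequentially"
    and a: "\<And>n. a n \<in> X" and nz: "\<And>n. k (a n) \<noteq> 0" and f: "f \<in> H"
  shows "(\<lambda>n. cmod (f (a n)) / hnorm ip (k (a n))) \<longlonglongrightarrow> hnorm ip (f - orth_proj ip N f)"
proof -
  let ?P = "\<lambda>n. orth_proj ip (zero_space H (a n)) f" and ?Q = "orth_proj ip N f"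
  have N: "N \<in> grassmannian H ip"
    using lim by (simp add: gr_topology_def gr_metric.limitin_mspace)
  have mem: "?P n \<in> H" "?Q \<in> H" for n
    using N f a zero_space_mem_grassmannian by auto
  have "(\<lambda>n. hnorm ip (f - ?P n)) \<longlonglongrightarrow> hnorm ip (f - ?Q)"
  proof (rule LIM_zero_cancel, rule Lim_null_comparison)
    show "(\<lambda>n. hnorm ip (?P n - ?Q)) \<longlonglongrightarrow> 0"
      using tendsto_orth_proj[OF lim _ f] a zero_space_mem_grassmannian by blast
    have "norm (hnorm ip (f - ?P n) - hnorm ip (f - ?Q)) \<le> hnorm ip (?P n - ?Q)" for n
      using hnorm_triangle_sub[of "f - ?P n" "f - ?Q"] hnorm_triangle_sub[of "f - ?Q" "f - ?P n"]
        hnorm_diff_commute[of "?P n" ?Q] f mem by (simp add: abs_le_iff)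
    then show "\<forall>\<^sub>F n in sequentially. norm (hnorm ip (f - ?P n) - hnorm ip (f - ?Q)) \<le> hnorm ip (?P n - ?Q)"
      by simp
  qed
  then show ?thesis using hnorm_diff_orth_proj_zero_space a nz f by simp
qed

text \<open>Membership in \<open>N\<close> means that the residual vanishes, and its norm is the
  limit just found. Questions about \<open>N\<close> thereby become questions about scalar
  sequences.\<close>

lemma mem_limit_iff:
  assumes lim: "limitin (gr_topology H ip) (\<lambda>n. zero_space H (a n)) N sequentially"
    and a: "\<And>n. a n \<in> X" and nz: "\<And>n. k (a n) \<noteq> 0" and f: "f \<in> H"
  shows "f \<in> N \<longleftrightarrow> (\<lambda>n. cmod (f (a n)) / hnorm ip (k (a n))) \<longlonglongrightarrow> 0"
proof -
  have N: "N \<in> grassmannian H ip"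
    using lim by (simp add: gr_topology_def gr_metric.limitin_mspace)
  have "f \<in> N \<longleftrightarrow> f - orth_proj ip N f = 0"
    using orth_proj_id[OF N] orth_proj_in[OF N f] by auto
  also have "\<dots> \<longleftrightarrow> hnorm ip (f - orth_proj ip N f) = 0"
    using N f by (subst hnorm_eq_0_iff) auto
  also have "\<dots> \<longleftrightarrow> (\<lambda>n. cmod (f (a n)) / hnorm ip (k (a n))) \<longlonglongrightarrow> 0"
    using tendsto_normalized_eval[OF lim a nz f] by (metis LIMSEQ_unique)
  finally show ?thesis .
qed

text \<open>The interior case. Expanding the squared norm of \<open>k (a n) - k b\<close> leaves
  only kernel values, so \<open>diag\<close> and \<open>off\<close> already force norm convergence
  of the kernels; hence \<open>f (a n)\<close> tends to \<open>f b\<close> in modulus for every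
  \<open>f\<close> in \<open>H\<close>.\<close>

lemma limit_eq_zero_space:
  assumes lim: "limitin (gr_topology H ip) (\<lambda>n. zero_space H (a n)) N sequentially"
    and a: "\<And>n. a n \<in> X" and nz: "\<And>w. w \<in> X \<Longrightarrow> k w \<noteq> 0"
    and b: "b \<in> X" and diag: "(\<lambda>n. k (a n) (a n)) \<longlonglongrightarrow> k b b" and off: "(\<lambda>n. k (a n) b) \<longlonglongrightarrow> k b b"
  shows "N = zero_space H b"
proof -
  have sq: "(hnorm ip (k w))\<^sup>2 = Re (k w w)" if "w \<in> X" for w
    using that by (simp add: hnorm_sq kernel_mem ip_kernel)
  have "(\<lambda>n. (hnorm ip (k (a n) - k b))\<^sup>2) \<longlonglongrightarrow> Re (k b b) - 2 * Re (k b b) + Re (k b b)"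
    using a b by (simp only: hnorm_sq_diff kernel_mem sq ip_kernel)
      (intro tendsto_intros diag off)
  from tendsto_real_sqrt[OF this] have kernels: "(\<lambda>n. hnorm ip (k (a n) - k b)) \<longlonglongrightarrow> 0"
    by (simp add: kernel_mem a b)
  have "(\<lambda>n. (hnorm ip (k (a n)))\<^sup>2) \<longlonglongrightarrow> (hnorm ip (k b))\<^sup>2"
    using a b by (simp only: sq) (intro tendsto_intros diag)
  from tendsto_real_sqrt[OF this] have norms: "(\<lambda>n. hnorm ip (k (a n))) \<longlonglongrightarrow> hnorm ip (k b)"
    by (simp add: kernel_mem a b)
  have pos: "hnorm ip (k b) > 0" using nz b kernel_mem hnorm_pos by blast
  have "f \<in> N \<longleftrightarrow> f b = 0" if f: "f \<in> H" for f
  proof -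
    \<comment> \<open>The kernel stands in the first slot here and in the second in
      \<open>reproducing\<close>; the swap conjugates the value, which the modulus ignores.\<close>
    have "(\<lambda>n. ip (k (a n)) f) \<longlonglongrightarrow> ip (k b) f"
      using tendsto_ip_left[of "\<lambda>n. k (a n)" "k b"] a b f kernel_mem kernels by blast
    then have "(\<lambda>n. cmod (ip (k (a n)) f)) \<longlonglongrightarrow> cmod (ip (k b) f)" by (rule tendsto_norm)
    moreover have "cmod (ip (k w) f) = cmod (f w)" if "w \<in> X" for w
      using reproducing[OF that f] ip_commute[of f "k w"] that f kernel_mem by simp
    ultimately have "(\<lambda>n. cmod (f (a n))) \<longlonglongrightarrow> cmod (f b)" using a b by simp
    then have "(\<lambda>n. cmod (f (a n)) / hnorm ip (k (a n))) \<longlonglongrightarrow> cmod (f b) / hnorm ip (k b)"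
      using norms pos by (intro tendsto_divide) auto
    then have "(\<lambda>n. cmod (f (a n)) / hnorm ip (k (a n))) \<longlonglongrightarrow> 0 \<longleftrightarrow> cmod (f b) / hnorm ip (k b) = 0"
      by (metis LIMSEQ_unique)
    then show ?thesis using mem_limit_iff[OF lim a nz[OF a] f] pos by simp
  qed
  moreover have "N \<subseteq> H"
    using lim gr_metric.limitin_mspace by (force simp: gr_topology_def grassmannian_iff)
  ultimately show ?thesis by (auto simp: zero_space_def)
qed

text \<open>A residual orthogonal to all kernels vanishes on \<open>X\<close> by the reproducing
  property and off \<open>X\<close> by \<open>vanish_outside\<close>, so it is the zero
  function.\<close>

lemma grassmannian_eq_H_if_kernels:
  assumes N: "N \<in> grassmannian H ip" and kN: "\<And>z. z \<in> X \<Longrightarrow> k z \<in> N"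
  shows "N = H"
proof (rule antisym)
  show "H \<subseteq> N"
  proof
    fix f assume f: "f \<in> H"
    define g where "g = f - orth_proj ip N f"
    have g: "g \<in> H" using N f by (simp add: g_def)
    have "g z = 0" for z
    proof (cases "z \<in> X")
      case True
      then show ?thesis
        using reproducing[OF True g] orth_proj_orthogonal[OF N f kN] by (simp add: g_def)
    qed (use g vanish_outside in blast)
    then have "g = 0" by (simp add: fun_eq_iff)
    then show "f \<in> N" using orth_proj_in[OF N f] by (simp add: g_def)
  qed
qed (use N in \<open>simp add: grassmannian_iff\<close>)

text \<open>Test on \<open>k a\<close>: projection onto \<open>H\<close> fixes it, while its
  residual for \<open>zero_space H a\<close> has the full norm of \<open>k a\<close>.\<close>

lemma gr_dist_zero_space_H_ge:
  assumes "a \<in> X" "k a \<noteq> 0" and H: "H \<in> grassmannian H ip"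
  shows "1 \<le> gr_dist H ip (zero_space H a) H"
proof -
  let ?P = "orth_proj ip (zero_space H a) (k a)"
  have mem: "k a \<in> H" "zero_space H a \<in> grassmannian H ip"
    using assms kernel_mem zero_space_mem_grassmannian by auto
  have pos: "hnorm ip (k a) > 0" using assms mem hnorm_pos by blast
  have "k a a = complex_of_real ((hnorm ip (k a))\<^sup>2)"
    using assms mem by (simp add: ip_self flip: ip_kernel)
  then have "cmod (k a a) = (hnorm ip (k a))\<^sup>2" by (metis abs_power2 norm_of_real)
  then have "hnorm ip (k a) = hnorm ip (k a - ?P)"
    using hnorm_diff_orth_proj_zero_space[of a "k a"] assms mem pos by (simp add: power2_eq_square)
  also have "\<dots> = hnorm ip (?P - orth_proj ip H (k a))"
    using mem H by (simp add: orth_proj_id hnorm_diff_commute)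
  also have "\<dots> \<le> gr_dist H ip (zero_space H a) H * hnorm ip (k a)"
    using mem H by (intro hnorm_orth_proj_diff_le) auto
  finally show ?thesis using pos by simp
qed

text \<open>The boundary case: normalised kernels tending to 0 pointwise on \<open>X\<close> would
  force \<open>N = H\<close>, against the distance bound.\<close>

lemma not_vanishing_at_limit:
  assumes lim: "limitin (gr_topology H ip) (\<lambda>n. zero_space H (a n)) N sequentially"
    and a: "\<And>n. a n \<in> X" and nz: "\<And>n. k (a n) \<noteq> 0"
    and null: "\<And>z. z \<in> X \<Longrightarrow> (\<lambda>n. k (a n) z / complex_of_real (hnorm ip (k (a n)))) \<longlonglongrightarrow> 0"
  shows False
proof -
  have N: "N \<in> grassmannian H ip"
    using lim by (simp add: gr_topology_def gr_metric.limitin_mspace)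
  have "k z \<in> N" if z: "z \<in> X" for z
  proof -
    \<comment> \<open>In \<open>null\<close> the moving point is the index of the kernel, in
      \<open>mem_limit_iff\<close> it is the argument; Hermitian symmetry exchanges them up to
      conjugation.\<close>
    have "cmod (k z (a n)) / hnorm ip (k (a n)) = cmod (k (a n) z / complex_of_real (hnorm ip (k (a n))))" for n
      using kernel_commute[OF z a] a kernel_mem by (simp add: norm_divide)
    then show ?thesis
      using tendsto_norm_zero[OF null[OF z]] mem_limit_iff[OF lim a nz kernel_mem[OF z]] by simp
  qed
  then have NH: "N = H" using grassmannian_eq_H_if_kernels N by blast
  have "(\<lambda>n. gr_dist H ip (zero_space H (a n)) H) \<longlonglongrightarrow> 0"
    using lim by (simp add: gr_topology_def gr_metric.limitin_metric_dist_null NH)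
  then have "1 \<le> (0::real)"
    using gr_dist_zero_space_H_ge a nz N NH by (intro LIMSEQ_le_const) auto
  then show False by simp
qed

end

section \<open>Sequences in the one-point compactification\<close>

lemma Alexandroff_compactification_subsequence:
  fixes a :: "nat \<Rightarrow> 'y::euclidean_space"
  obtains r p where "strict_mono r"
    "limitin (Alexandroff_compactification euclidean) (\<lambda>n. Some (a (r n))) p sequentially"
proof (cases "\<exists>R. infinite {n. norm (a n) \<le> R}")
  case True
  then obtain R where R: "infinite {n. norm (a n) \<le> R}" by blast
  \<comment> \<open>\<open>s\<close> lists the infinitely many indices whose terms lie in one closed
    ball; compactness of the ball then yields a finite limit.\<close>
  define s where "s = enumerate {n. norm (a n) \<le> R}"
  have s: "strict_mono s" using R by (simp add: s_def strict_mono_enumerate)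
  have "\<forall>n. (a \<circ> s) n \<in> cball 0 R"
    using enumerate_in_set[OF R] by (simp add: s_def)
  then obtain l t where t: "strict_mono t" and "((a \<circ> s) \<circ> t) \<longlonglongrightarrow> l"
    using compact_cball[of "0::'y" R, unfolded compact_def] by blast
  then have l: "(\<lambda>n. a (s (t n))) \<longlonglongrightarrow> l" by (simp add: o_def)
  show thesis
  proof (rule that)
    show "strict_mono (s \<circ> t)" using s t by (rule strict_mono_o)
    show "limitin (Alexandroff_compactification euclidean) (\<lambda>n. Some (a ((s \<circ> t) n))) (Some l) sequentially"
      using continuous_map_limit[OF continuous_map_Some, of euclidean "\<lambda>n. a (s (t n))" l sequentially] l
      by (simp add: o_def)
  qed
next
  \<comment> \<open>Now every ball contains only finitely many terms, so the whole sequence tends to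
    infinity and no thinning out is necessary.\<close>
  case False
  show thesis
  proof (rule that)
    show "strict_mono (\<lambda>n::nat. n)" by (simp add: strict_mono_def)
    show "limitin (Alexandroff_compactification euclidean) (\<lambda>n. Some (a n)) None sequentially"
      unfolding limitin_def
    proof (intro conjI allI impI)
      fix U :: "'y option set"
      assume "openin (Alexandroff_compactification euclidean) U \<and> None \<in> U"
      \<comment> \<open>Open neighbourhoods of infinity are complements of compact sets;
        \<open>C\<close> lies in a ball, so only finitely many terms miss \<open>U\<close>.\<close>
      then obtain C where "compact C" and U: "U = insert None (Some ` (- C))"
        by (auto simp: openin_Alexandroff_compactification Compl_eq_Diff_UNIV)
      then obtain R where R: "\<And>x. x \<in> C \<Longrightarrow> norm x \<le> R"
        using compact_imp_bounded bounded_iff by metis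
      have "{n. \<not> Some (a n) \<in> U} \<subseteq> {n. norm (a n) \<le> R}" using R by (auto simp: U)
      then have "finite {n. \<not> Some (a n) \<in> U}" using False finite_subset by blast
      then show "\<forall>\<^sub>F n in sequentially. Some (a n) \<in> U"
        by (simp add: eventually_cofinite flip: cofinite_eq_sequentially)
    qed simp
  qed
qed

text \<open>Every neighbourhood of \<open>p\<close> contains a term of the sequence, so
  \<open>p\<close> is in the closure; lying outside the set, it is not interior. Both infinity and
  finite limits outside \<open>X\<close> are covered.\<close>

lemma limitin_compactified_boundary:
  assumes lim: "limitin (Alexandroff_compactification euclidean) (\<lambda>n. Some (a n)) p sequentially"
    and a: "\<And>n. a n \<in> X" and p: "p \<notin> Some ` X"
  shows "p \<in> compactified_boundary X"
proof -
  have "p \<in> Alexandroff_compactification euclidean closure_of Some ` X"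
    unfolding in_closure_of
  proof (intro conjI allI impI)
    show "p \<in> topspace (Alexandroff_compactification euclidean)" by (rule limitin_topspace[OF lim])
    fix T assume "p \<in> T \<and> openin (Alexandroff_compactification euclidean) T"
    then have "\<forall>\<^sub>F n in sequentially. Some (a n) \<in> T" using lim by (simp add: limitin_def)
    then obtain n where "Some (a n) \<in> T" using eventually_happens by force
    then show "\<exists>y. y \<in> Some ` X \<and> y \<in> T" using a by blast
  qed
  moreover have "p \<notin> Alexandroff_compactification euclidean interior_of Some ` X"
    using p interior_of_subset[of _ "Some ` X"] by blast
  ultimately show ?thesis by (simp add: compactified_boundary_def frontier_of_def)
qed

text \<open>The image of an open set under \<open>Some\<close> is open in the compactification, so
  neighbourhoods of \<open>b\<close> transfer.\<close>

lemma limitin_Alexandroff_Some: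
  assumes "limitin (Alexandroff_compactification euclidean) (\<lambda>n. Some (a n)) (Some b) sequentially"
  shows "a \<longlonglongrightarrow> b"
proof (rule topological_tendstoI)
  fix S assume "open S" "b \<in> S"
  then have "\<forall>\<^sub>F n in sequentially. Some (a n) \<in> Some ` S"
    using assms by (simp add: limitin_def)
  then show "\<forall>\<^sub>F n in sequentially. a n \<in> S" by (simp add: inj_image_mem_iff)
qed

theorem proposition3p7:
  fixes X :: "'y::euclidean_space set"
    and H :: "('y \<Rightarrow> complex) set"
    and ip :: "('y \<Rightarrow> complex) \<Rightarrow> ('y \<Rightarrow> complex) \<Rightarrow> complex"
    and k :: "'y \<Rightarrow> 'y \<Rightarrow> complex"
  assumes rkhs: "rkhs X H ip k"
    and inf_dim: "infinite_dimensional H"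
    and kernel_nonzero: "\<And>a. a \<in> X \<Longrightarrow> k a \<noteq> 0"
    and kernel_independent:
      "\<And>a b. \<lbrakk>a \<in> X; b \<in> X; a \<noteq> b\<rbrakk> \<Longrightarrow> k a \<noteq> k b \<and> cfun.independent {k a, k b}"
    and boundary_limit:
      "\<And>w p z. \<lbrakk>\<And>n. w n \<in> X; p \<in> compactified_boundary X - Some ` X;
          limitin (Alexandroff_compactification euclidean) (\<lambda>n::nat. Some (w n)) p sequentially;
          z \<in> X\<rbrakk>
        \<Longrightarrow> (\<lambda>n. k (w n) z / complex_of_real (hnorm ip (k (w n)))) \<longlonglongrightarrow> 0"
    and kernel_continuous: "continuous_on (X \<times> X) (\<lambda>(z, w). k w z)"
  shows "closedin (gr_topology H ip) (gr_points X H)"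
proof -
  interpret rkhs X H ip k by (rule rkhs)
  show ?thesis
    unfolding gr_topology_def gr_metric.metric_closedin_iff_sequentially_closed
  proof (intro conjI allI impI)
    show "gr_points X H \<subseteq> grassmannian H ip"
      by (auto simp: gr_points_def zero_space_mem_grassmannian)
    fix \<sigma> N
    assume "range \<sigma> \<subseteq> gr_points X H \<and> limitin gr_metric.mtopology \<sigma> N sequentially"
    then have "\<forall>n. \<exists>a. a \<in> X \<and> \<sigma> n = zero_space H a"
      and \<sigma>: "limitin (gr_topology H ip) \<sigma> N sequentially"
      by (auto simp: gr_points_def gr_topology_def)
    then obtain a where a: "\<And>n. a n \<in> X" and \<sigma>_eq: "\<And>n. \<sigma> n = zero_space H (a n)" by metis
    obtain r p where r: "strict_mono r"
      and p: "limitin (Alexandroff_compactification euclidean) (\<lambda>n. Some (a (r n))) p sequentially"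
      using Alexandroff_compactification_subsequence by blast
    define b where "b = a \<circ> r"
    have bX: "b n \<in> X" for n using a by (simp add: b_def)
    have lim_b: "limitin (Alexandroff_compactification euclidean) (\<lambda>n. Some (b n)) p sequentially"
      using p by (simp add: b_def)
    \<comment> \<open>A subsequence has the same limit \<open>N\<close>, so passing to
      \<open>b\<close> loses nothing.\<close>
    have lim: "limitin (gr_topology H ip) (\<lambda>n. zero_space H (b n)) N sequentially"
      using limitin_subsequence[OF r \<sigma>] by (simp add: b_def o_def \<sigma>_eq)
    have "p \<in> Some ` X"
    proof (rule ccontr)
      assume "p \<notin> Some ` X"
      then have "p \<in> compactified_boundary X - Some ` X"
        using limitin_compactified_boundary[OF lim_b bX] by blast
      then show False
        using boundary_limit[OF bX _ lim_b] not_vanishing_at_limit[OF lim bX kernel_nonzero[OF bX]] by blast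
    qed
    then obtain c where c: "c \<in> X" "p = Some c" by blast
    have bc: "b \<longlonglongrightarrow> c" using limitin_Alexandroff_Some lim_b c by blast
    \<comment> \<open>Two separate sequences, so that one statement serves both the diagonal values
      (\<open>u\<close> and \<open>v\<close> both \<open>b\<close>) and the values at
      \<open>c\<close> (\<open>u\<close> constant).\<close>
    have kernel_lim: "(\<lambda>n. k (v n) (u n)) \<longlonglongrightarrow> k c c"
      if "u \<longlonglongrightarrow> c" "v \<longlonglongrightarrow> c" "\<And>n. u n \<in> X" "\<And>n. v n \<in> X" for u v
      using continuous_on_tendsto_compose[OF kernel_continuous tendsto_Pair[OF that(1,2)]] that c by simp
    have "N = zero_space H c"
      using kernel_lim[OF bc bc bX bX] kernel_lim[OF tendsto_const bc c(1) bX]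
      by (intro limit_eq_zero_space[OF lim bX kernel_nonzero c(1)])
    then show "N \<in> gr_points X H" using c by (auto simp: gr_points_def)
  qed
qed

end
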